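(* Let $\mathcal{I}$ be an instance consisting of $n$ tasks with intervals $[s_i,e_i)$, $i\in[n]$, and $q$ workers, as described in the context (basic version). The following statements are equivalent: (a) There exists a feasible assignment $f$ and a worker $j\in[q]$ such that $j$ performs each task at least once, i.e., for every $i\in[n]$ there is $r\in\mathbb{Z}_{>0}$ with $f(i,r)=j$. (b) There exists a balanced feasible assignment. (c) There exists a balanced feasible assignment that is periodic with period $q$.
   Context: An instance $\mathcal{I}$ consists of a positive integer $n$, $n$ intervals $[s_i,e_i)\subseteq(-1,1)$, $i\in[n]=\{1,\dots,n\}$ (called tasks), with $e_i\in(0,1]$ and $e_i-s_i\le 1$, and a positive integer $q$; the workers are identified with $[q]$. For $r\in\mathbb{Z}_{>0}$, the $r$th occurrence of task $i$ occupies the time interval $[s_i+r,e_i+r)$. An assignment is a map $f:[n]\times\mathbb{Z}_{>0}\to[q]$ ($f(i,r)=j$ means the $r$th occurrence of task $i$ is performed by worker $j$). An assignment is feasible if for all $i\neq i'$ in $[n]$ and all $r,r'\in\mathbb{Z}_{>0}$, $[s_i+r,e_i+r)\cap[s_{i'}+r',e_{i'}+r')\neq\varnothing$ implies $f(i,r)\neq f(i',r')$. It is balanced if for every $i\in[n]$ and $j\in[q]$ the limit $\lim_{t\to\infty}\frac1t\,|\{r\in[t]: f(i,r)=j\}|$ exists and equals $1/q$. It is periodic with period $h\in\mathbb{Z}_{>0}$ if $f(i,r)=f(i,r+h)$ for all $i\in[n]$, $r\in\mathbb{Z}_{>0}$. *)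

theory Defs
  imports Complex_Main "HOL-Library.FuncSet"
begin

text \<open>
  An instance is given by the number \<open>n\<close> of tasks, the endpoints \<open>s\<close>, \<open>e\<close> of the task intervals
  (only their values on \<open>{1..n}\<close> matter) and the number \<open>q\<close> of workers. An empty interval
  \<open>[s\<^sub>i, e\<^sub>i)\<close> with \<open>e\<^sub>i \<le> s\<^sub>i\<close> is not excluded.
\<close>

definition is_instance :: "nat \<Rightarrow> (nat \<Rightarrow> real) \<Rightarrow> (nat \<Rightarrow> real) \<Rightarrow> nat \<Rightarrow> bool" where
  "is_instance n s e q \<longleftrightarrow>
     n > 0 \<and> q > 0 \<and>
     (\<forall>i\<in>{1..n}. {s i..<e i} \<subseteq> {-1<..<1} \<and> e i \<in> {0<..1} \<and> e i - s i \<le> 1)"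

definition occurrence :: "(nat \<Rightarrow> real) \<Rightarrow> (nat \<Rightarrow> real) \<Rightarrow> nat \<Rightarrow> nat \<Rightarrow> real set" where
  "occurrence s e i r = {s i + real r..<e i + real r}"

definition assignments :: "nat \<Rightarrow> nat \<Rightarrow> (nat \<times> nat \<Rightarrow> nat) set" where
  "assignments n q = ({1..n} \<times> {1..}) \<rightarrow> {1..q}"

definition feasible ::
  "nat \<Rightarrow> (nat \<Rightarrow> real) \<Rightarrow> (nat \<Rightarrow> real) \<Rightarrow> (nat \<times> nat \<Rightarrow> nat) \<Rightarrow> bool" where
  "feasible n s e f \<longleftrightarrow>
     (\<forall>i\<in>{1..n}. \<forall>i'\<in>{1..n}. \<forall>r\<ge>1. \<forall>r'\<ge>1.
        i \<noteq> i' \<longrightarrow> occurrence s e i r \<inter> occurrence s e i' r' \<noteq> {} \<longrightarrow> f (i, r) \<noteq> f (i', r'))"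

definition balanced :: "nat \<Rightarrow> nat \<Rightarrow> (nat \<times> nat \<Rightarrow> nat) \<Rightarrow> bool" where
  "balanced n q f \<longleftrightarrow>
     (\<forall>i\<in>{1..n}. \<forall>j\<in>{1..q}.
        (\<lambda>t. 1 / real t * real (card {r \<in> {1..t}. f (i, r) = j})) \<longlonglongrightarrow> 1 / real q)"

definition periodic :: "nat \<Rightarrow> nat \<Rightarrow> (nat \<times> nat \<Rightarrow> nat) \<Rightarrow> bool" where
  "periodic n h f \<longleftrightarrow> h > 0 \<and> (\<forall>i\<in>{1..n}. \<forall>r\<ge>1. f (i, r) = f (i, r + h))"

end

theory Submission
  imports Defs "HOL-Combinatorics.Orbits"
begin

text \<open>
  A balanced assignment of period \<open>q\<close> is obtained from shifts \<open>a i\<close> such that the intervals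
  \<open>[s i + a i, e i + a i)\<close> are disjoint on a circle of length \<open>q\<close>: let the \<open>q\<close> workers run round
  this circle, one unit of time apart. To find the shifts, fill idle time with unit tasks so that
  exactly \<open>q\<close> tasks are in progress at any moment. Then at each time of day as many tasks start as
  end, so some permutation \<open>\<sigma>\<close> of the tasks sends each task to one that starts when it ends; a cycle
  of \<open>\<sigma>\<close>, laid end to end, packs its tasks on a circle of length at most \<open>q\<close>. Composing \<open>\<sigma>\<close> with the
  transposition of two tasks that end at the same time of day merges their cycles if they are
  different. Hence, in a longest cycle through a given task, all tasks that a worker can reach
  from it appear; a worker who performs every task forces this cycle to contain all of them.
\<close>

section \<open>Integer quotients as counters, and the density of residue classes\<close>

lemma div_succ_diff:
  fixes x m :: int
  assumes "m > 0"
  shows "(x + 1) div m - x div m = (if m dvd x + 1 then 1 else 0)"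
proof -
  have "0 \<le> x mod m" "x mod m < m" using assms by simp_all
  then show ?thesis
  proof (cases "x mod m + 1 = m")
    case True
    have "x + 1 = m * (x div m + 1)"
      using True mult_div_mod_eq[of m x] unfolding distrib_left by linarith
    then show ?thesis using assms by simp
  next
    case False
    have r: "x + 1 = m * (x div m) + (x mod m + 1)" by simp
    have "0 < x mod m + 1" "x mod m + 1 < m"
      using False assms \<open>x mod m < m\<close> \<open>0 \<le> x mod m\<close> by linarith+
    then have "(x + 1) div m = x div m" "(x + 1) mod m = x mod m + 1"
      using int_div_pos_eq[OF r] int_mod_pos_eq[OF r] by simp_all
    then show ?thesis using \<open>0 < x mod m + 1\<close> by (auto simp: dvd_eq_mod_eq_0)
  qed
qed

text \<open>Used with \<open>x = k - S i\<close> and \<open>d = E i - S i\<close>: up to a common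
  constant, the two quotients count the occurrences of task \<open>i\<close> started and ended by
  slot \<open>k\<close>, so the difference is 1 exactly while one is in progress.\<close>

lemma div_diff_eq_indicator:
  fixes x d m :: int
  assumes "0 < d" "d \<le> m"
  shows "x div m - (x - d) div m = (if x mod m < d then 1 else 0)"
proof (cases "x mod m < d")
  case True
  have "x - d = m * (x div m - 1) + (x mod m - d + m)"
    by (simp add: algebra_simps)
  moreover have "0 \<le> x mod m - d + m" "x mod m - d + m < m" 
    using assms True pos_mod_sign[of m x] by linarith+
  ultimately have "(x - d) div m = x div m - 1" by (rule int_div_pos_eq)
  then show ?thesis using True by simp
next
  case False
  have "x - d = m * (x div m) + (x mod m - d)"
    by (simp add: algebra_simps)
  moreover have "0 \<le> x mod m - d" "x mod m - d < m" 
    using assms False pos_mod_bound[of m x] by linarith+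
  ultimately have "(x - d) div m = x div m" by (rule int_div_pos_eq)
  then show ?thesis using False by simp
qed

lemma card_residue_class:
  fixes b :: int and q t :: nat
  assumes "q > 0"
  shows "int (card {r \<in> {1..t}. (int r - b) mod int q = 0})
    = (int t - b) div int q - (- b) div int q"
proof (induction t)
  case (Suc t)
  have "{r \<in> {1..Suc t}. (int r - b) mod int q = 0} =
    {r \<in> {1..t}. (int r - b) mod int q = 0} \<union>
      (if int q dvd (int t - b) + 1 then {Suc t} else {})"
    by (auto simp: le_Suc_eq dvd_eq_mod_eq_0 algebra_simps)
  then have "int (card {r \<in> {1..Suc t}. (int r - b) mod int q = 0}) =
    int (card {r \<in> {1..t}. (int r - b) mod int q = 0}) +
      (if int q dvd (int t - b) + 1 then 1 else 0)"
    by (auto simp: card_insert_if)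
  then show ?case
    using Suc div_succ_diff[of "int q" "int t - b"] assms by (simp add: algebra_simps)
qed simp

lemma residue_class_density:
  fixes b :: int and q :: nat
  assumes "q > 0"
  shows "(\<lambda>t. 1 / real t * real (card {r \<in> {1..t}. (int r - b) mod int q = 0}))
    \<longlonglongrightarrow> 1 / real q"
proof -
  define N where "N t = real (card {r \<in> {1..t}. (int r - b) mod int q = 0})" for t
  \<comment> \<open>The three terms account for the shift by \<open>b\<close>, the rounding of the
    floor, and the constant offset of the count.\<close>
  define C where "C = \<bar>real_of_int b\<bar> / real q + 1 + \<bar>real_of_int ((- b) div int q)\<bar>"
  have N: "N t = of_int \<lfloor>(real t - real_of_int b) / real q\<rfloor> - of_int ((- b) div int q)" for t
  proof -
    have "N t = of_int (int (card {r \<in> {1..t}. (int r - b) mod int q = 0}))"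
      unfolding N_def by simp
    also have "\<dots> = of_int ((int t - b) div int q) - of_int ((- b) div int q)"
      using card_residue_class[OF assms] by simp
    also have "(int t - b) div int q = \<lfloor>(real t - real_of_int b) / real q\<rfloor>"
      using floor_divide_of_int_eq[of "int t - b" "int q", where ?'a = real] by simp
    finally show ?thesis .
  qed
  have bound: "\<bar>N t - real t / real q\<bar> \<le> C" for t
  proof -
    have "(real t - real_of_int b) / real q = real t / real q - real_of_int b / real q"
      by (simp add: diff_divide_distrib)
    moreover have "\<bar>real_of_int b / real q\<bar> = \<bar>real_of_int b\<bar> / real q" by simp
    ultimately show ?thesis unfolding N C_def by linarith
  qed
  have "(\<lambda>t. 1 / real t * N t - 1 / real q) \<longlonglongrightarrow> 0"
  proof (rule tendsto_0_le)
    show "\<forall>\<^sub>F t in sequentially. norm (1 / real t * N t - 1 / real q) \<le> norm (C / real t) * 1"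
      using eventually_gt_at_top[of 0]
    proof eventually_elim
      case (elim t)
      have "1 / real t * N t - 1 / real q = (N t - real t / real q) / real t"
        using elim by (simp add: field_simps)
      moreover have "\<bar>N t - real t / real q\<bar> \<le> \<bar>C\<bar>" using bound[of t] by linarith
      ultimately show ?case by (simp add: divide_right_mono)
    qed
    show "(\<lambda>t. C / real t) \<longlonglongrightarrow> 0"
      by (rule lim_const_over_n)
  qed
  then show ?thesis unfolding N_def by (rule LIM_zero_cancel)
qed

section \<open>Permutations matching ends with starts, and the packing of one cycle\<close>

text \<open>The composite sends \<open>x\<close> to \<open>\<sigma> y\<close> and \<open>y\<close>
  to \<open>\<sigma> x\<close>. From \<open>x\<close> it therefore runs through the whole old cycle
  of \<open>y\<close>, ending at \<open>y\<close>, and then through the old cycle of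
  \<open>x\<close>.\<close>

lemma orbit_comp_swap_superset:
  assumes p: "\<sigma> permutes T" and fin: "finite T" and x: "x \<in> orbit \<sigma> x0" and y: "y \<notin> orbit \<sigma> x0"
  shows "orbit \<sigma> x0 \<union> {y} \<subseteq> orbit (\<sigma> \<circ> transpose x y) x0"
proof -
  let ?p = "\<sigma> \<circ> transpose x y"
  have perm: "permutation \<sigma>" using p fin permutation_permutes by blast
  have perm': "permutation ?p" using perm by (simp add: permutation_compose permutation_swap_id)
  have ox: "orbit \<sigma> x = orbit \<sigma> x0"
    by (rule orbit_cyclic_eq3[OF cyclic_on_orbit'[OF perm] x])
  have disj: "x \<notin> orbit \<sigma> y"
  proof
    assume "x \<in> orbit \<sigma> y"
    then have "y \<in> orbit \<sigma> x"
      by (rule orbit_swap[OF permutation_self_in_orbit[OF perm]])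
    then show False using y ox by simp
  qed
  \<comment> \<open>Starting at \<open>x\<close>, where the cycles are spliced, suits both
    inductions; \<open>x0\<close> turns out to lie on the merged cycle.\<close>
  let ?O = "orbit ?p x"
  have *: "z \<in> ?O" if "z \<in> orbit \<sigma> y" for z
    using that
  proof induction
    case base
    show ?case by (simp add: orbit_eqI(1))
  next
    case (step z)
    show ?case
    proof (cases "z = y")
      case True
      then show ?thesis by (simp add: orbit_eqI(1))
    next
      case False
      then have "?p z = \<sigma> z" using step disj by (auto simp: transpose_def)
      then show ?thesis using orbit.step[OF step.IH] by simp
    qed
  qed
  have yO: "y \<in> ?O" using * perm by (simp add: permutation_self_in_orbit)
  have sx: "\<sigma> x \<in> ?O" using orbit.step[OF yO] by simp
  have "z \<in> ?O" if "z \<in> orbit \<sigma> x" for z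
    using that
  proof induction
    case base show ?case by (rule sx)
  next
    case (step z)
    show ?case
    proof (cases "z = x")
      case True
      then show ?thesis using sx by metis
    next
      case False
      moreover have "z \<noteq> y" using step ox y by auto
      ultimately have "?p z = \<sigma> z" by (auto simp: transpose_def)
      then show ?thesis using orbit.step[OF step.IH] by simp
    qed
  qed
  then have sub: "orbit \<sigma> x0 \<union> {y} \<subseteq> ?O" using ox yO by auto
  moreover have "x0 \<in> orbit \<sigma> x0" using perm by (simp add: permutation_self_in_orbit)
  ultimately have "x0 \<in> ?O" by auto
  then have "orbit ?p x0 = ?O"
    by (rule orbit_cyclic_eq3[OF cyclic_on_orbit'[OF perm']])
  then show ?thesis using sub by simp
qed

text \<open>From slot \<open>k - 1\<close> to slot \<open>k\<close> the load changes by the number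
  of starts minus the number of ends at \<open>k\<close> modulo \<open>m\<close>. Since it is
  constant, \<open>S\<close> and \<open>E\<close> have the same multiset of residues.\<close>

lemma ex_matching_permutation:
  fixes S E :: "'a \<Rightarrow> int"
  assumes fin: "finite T" and m: "m > 0"
    and load: "\<And>k. (\<Sum>i\<in>T. (k - S i) div m - (k - E i) div m) = q"
  obtains \<sigma> where "\<sigma> permutes T" "\<And>i. i \<in> T \<Longrightarrow> E i mod m = S (\<sigma> i) mod m"
proof -
  have jump: "(\<Sum>i\<in>T. (k + 1 - F i) div m) - (\<Sum>i\<in>T. (k - F i) div m)
      = int (card {i \<in> T. m dvd k + 1 - F i})" for k and F :: "'a \<Rightarrow> int"
  proof -
    have "(k + 1 - F i) div m - (k - F i) div m = (if m dvd k + 1 - F i then 1 else 0)" for i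
      using div_succ_diff[OF m, of "k - F i"] by (simp add: algebra_simps)
    then show ?thesis using fin
      by (simp add: sum_subtractf[symmetric] sum.If_cases Int_def)
  qed
  have starts_eq_ends: "card {i \<in> T. m dvd k - S i} = card {i \<in> T. m dvd k - E i}" for k
    using load[of k] load[of "k - 1"] jump[of "k - 1" S] jump[of "k - 1" E]
    by (simp add: sum_subtractf)
  have count: "count (image_mset (\<lambda>i. F i mod m) (mset_set T)) k
      = (if k mod m = k then card {i \<in> T. m dvd k - F i} else 0)" for k and F :: "'a \<Rightarrow> int"
  proof -
    have "count (image_mset (\<lambda>i. F i mod m) (mset_set T)) k = card {i \<in> T. k = F i mod m}"
      using fin by (simp add: count_image_mset')
    also have "{i \<in> T. k = F i mod m} = (if k mod m = k then {i \<in> T. m dvd k - F i} else {})"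
      by (auto simp: mod_eq_dvd_iff[symmetric])
    finally show ?thesis by simp
  qed
  have "image_mset (\<lambda>i. E i mod m) (mset_set T) = image_mset (\<lambda>i. S i mod m) (mset_set T)"
    by (rule multiset_eqI) (simp add: count starts_eq_ends)
  then obtain \<sigma> where "\<sigma> permutes T" "\<forall>i\<in>T. E i mod m = S (\<sigma> i) mod m"
    by (rule image_mset_eq_implies_permutes[OF fin])
  then show thesis by (intro that) auto
qed

text \<open>\<open>connected\<close> places \<open>R\<close> in the component of \<open>x0\<close>
  in the graph linking \<open>i\<close> to \<open>j\<close> when \<open>j\<close> can start as
  \<open>i\<close> ends. A longest orbit of \<open>x0\<close> is closed under these links, since
  otherwise a transposition would enlarge it.\<close>

lemma ex_matching_permutation_large_orbit:
  fixes S E :: "'a \<Rightarrow> int"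
  assumes fin: "finite T" and m: "m > 0" and x0: "x0 \<in> T"
    and load: "\<And>k. (\<Sum>i\<in>T. (k - S i) div m - (k - E i) div m) = q"
    and connected: "\<forall>U\<subseteq>T. x0 \<in> U \<longrightarrow>
      (\<forall>i\<in>T. \<forall>j\<in>T. E i mod m = S j mod m \<longrightarrow> (i \<in> U \<longleftrightarrow> j \<in> U)) \<longrightarrow> R \<subseteq> U"
  obtains \<sigma> where "\<sigma> permutes T" "\<And>i. i \<in> T \<Longrightarrow> E i mod m = S (\<sigma> i) mod m"
    "R \<subseteq> orbit \<sigma> x0"
proof -
  define P where "P \<sigma> \<longleftrightarrow> \<sigma> permutes T \<and> (\<forall>i\<in>T. E i mod m = S (\<sigma> i) mod m)" for \<sigma>
  have sub: "orbit \<sigma> x0 \<subseteq> T" if "P \<sigma>" for \<sigma>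
    using that permutes_orbit_subset x0 unfolding P_def by metis
  have "\<exists>\<sigma>. P \<sigma>"
    using ex_matching_permutation[OF fin m load] unfolding P_def by metis
  moreover have "card (orbit \<sigma> x0) < Suc (card T)" if "P \<sigma>" for \<sigma>
    using card_mono[OF fin sub[OF that]] by simp
  ultimately obtain \<sigma> where \<sigma>: "P \<sigma>"
    and max: "\<And>\<tau>. P \<tau> \<Longrightarrow> card (orbit \<tau> x0) \<le> card (orbit \<sigma> x0)"
    using ex_has_greatest_nat[of P _ "\<lambda>\<sigma>. card (orbit \<sigma> x0)" "Suc (card T)"] by metis
  have perm: "\<sigma> permutes T" and match: "\<And>i. i \<in> T \<Longrightarrow> E i mod m = S (\<sigma> i) mod m"
    using \<sigma> unfolding P_def by auto
  let ?U = "orbit \<sigma> x0"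
  have self: "x0 \<in> ?U"
    using perm fin by (intro permutation_self_in_orbit) (auto simp: permutation_permutes)
  have same_end: "y \<in> ?U" if "x \<in> ?U" "x \<in> T" "y \<in> T" "E x mod m = E y mod m" for x y
  proof (rule ccontr)
    assume y: "y \<notin> ?U"
    \<comment> \<open>As \<open>x\<close> and \<open>y\<close> end at the same residue, exchanging
      their successors keeps every end matched with a start, while the orbit gains
      \<open>y\<close>.\<close>
    let ?\<tau> = "\<sigma> \<circ> transpose x y"
    have "P ?\<tau>" unfolding P_def
    proof (intro conjI ballI)
      show "?\<tau> permutes T"
        using permutes_compose[OF permutes_swap_id perm] that by simp
      fix i assume "i \<in> T"
      then show "E i mod m = S (?\<tau> i) mod m"
        using match[of x] match[of y] match[of i] that by (auto simp: transpose_def)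
    qed
    have "insert y ?U \<subseteq> orbit ?\<tau> x0"
      using orbit_comp_swap_superset[OF perm fin that(1) y] by simp
    moreover have "finite (orbit ?\<tau> x0)" using sub[OF \<open>P ?\<tau>\<close>] fin finite_subset by blast
    ultimately have "card (insert y ?U) \<le> card (orbit ?\<tau> x0)" by (simp add: card_mono)
    moreover have "finite ?U" using sub[OF \<sigma>] fin finite_subset by blast
    ultimately show False using max[OF \<open>P ?\<tau>\<close>] y by simp
  qed
  have "R \<subseteq> ?U"
  proof (intro connected[rule_format] ballI impI)
    show "?U \<subseteq> T" by (rule sub[OF \<sigma>])
    show "x0 \<in> ?U" by (rule self)
    fix i j assume i: "i \<in> T" and j: "j \<in> T" and ij: "E i mod m = S j mod m"
    \<comment> \<open>The predecessor \<open>l\<close> of \<open>j\<close> shares the cycle of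
      \<open>j\<close> and ends when \<open>i\<close> does, which reduces the link to
      \<open>same_end\<close>.\<close>
    obtain l where l: "l \<in> T" "\<sigma> l = j"
      using j permutes_image[OF perm] by (metis imageE)
    have "l \<in> ?U \<longleftrightarrow> j \<in> ?U"
      using l(2) orbit.step[of l \<sigma> x0] cyclic_on_f_in[OF perm cyclic_on_orbit[OF perm fin]]
      by blast
    moreover have "E l mod m = E i mod m" using match[OF l(1)] l ij by simp
    ultimately show "i \<in> ?U \<longleftrightarrow> j \<in> ?U"
      using same_end i l(1) by metis
  qed
  show thesis by (rule that[OF perm _ \<open>R \<subseteq> ?U\<close>]) (rule match)
qed

text \<open>Laid end to end, the cycle closes up after a whole number of days. This number is the
  load its tasks cause in a slot, hence at most \<open>q\<close>. The term
  \<open>c * (q * m)\<close> expresses disjointness on a circle of \<open>q\<close> days.\<close>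

lemma ex_circular_packing:
  fixes S E :: "'a \<Rightarrow> int"
  assumes fin: "finite T" and m: "m > 0" and x0: "x0 \<in> T"
    and pos: "\<And>i. i \<in> T \<Longrightarrow> S i < E i"
    and load: "\<And>k. (\<Sum>i\<in>T. (k - S i) div m - (k - E i) div m) = q"
    and connected: "\<forall>U\<subseteq>T. x0 \<in> U \<longrightarrow>
      (\<forall>i\<in>T. \<forall>j\<in>T. E i mod m = S j mod m \<longrightarrow> (i \<in> U \<longleftrightarrow> j \<in> U)) \<longrightarrow> R \<subseteq> U"
  obtains a where "\<And>i j k c. i \<in> R \<Longrightarrow> j \<in> R \<Longrightarrow>
      k \<in> {S i + a i * m..<E i + a i * m} \<Longrightarrow> k + c * (q * m) \<in> {S j + a j * m..<E j + a j * m}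
      \<Longrightarrow> i = j"
proof -
  obtain \<sigma> where perm: "\<sigma> permutes T" and match: "\<And>i. i \<in> T \<Longrightarrow> E i mod m = S (\<sigma> i) mod m"
    and R: "R \<subseteq> orbit \<sigma> x0"
    using ex_matching_permutation_large_orbit[OF fin m x0 load connected] by blast
  have self: "x0 \<in> orbit \<sigma> x0"
    using perm fin by (intro permutation_self_in_orbit) (auto simp: permutation_permutes)
  define N where "N = funpow_dist1 \<sigma> x0 x0"
  define x where "x p = (\<sigma> ^^ p) x0" for p
  have orb: "orbit \<sigma> x0 = x ` {0..<N}"
    unfolding N_def x_def by (rule orbit_conv_funpow_dist1[OF self])
  have inj: "inj_on x {0..<N}"
    unfolding N_def x_def by (rule inj_on_funpow_dist1[OF self])
  have xN: "x N = x0"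
    unfolding N_def x_def by (rule funpow_dist1_prop[OF self])
  have xT: "x p \<in> T" for p
    unfolding x_def using x0 by (induction p) (auto simp: permutes_in_image[OF perm])
  \<comment> \<open>The tasks \<open>x 0, x 1, \<dots>\<close> of the orbit are laid end to end, \<open>x p\<close> starting at \<open>L p\<close>.\<close>
  define L where "L p = S x0 + (\<Sum>l<p. E (x l) - S (x l))" for p
  have L_Suc: "L (Suc p) = L p + (E (x p) - S (x p))" for p
    unfolding L_def by simp
  have L_mod: "L p mod m = S (x p) mod m" for p
  proof (induction p)
    case (Suc p)
    have "L (Suc p) mod m = (L p + (E (x p) - S (x p))) mod m" by (simp add: L_Suc)
    also have "\<dots> = (S (x p) + (E (x p) - S (x p))) mod m"
      using Suc by (rule mod_add_cong) simp
    also have "\<dots> = S (x (Suc p)) mod m" using match[OF xT] by (simp add: x_def)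
    finally show ?case .
  qed (simp add: L_def x_def)
  define b where "b p = (L p - S (x p)) div m" for p
  have b: "L p = S (x p) + b p * m" for p
  proof -
    have "m dvd L p - S (x p)" using L_mod[of p] by (simp add: mod_eq_dvd_iff)
    then show ?thesis unfolding b_def by simp
  qed
  have L_less: "L p < L (Suc p)" for p using pos[OF xT[of p]] by (simp add: L_Suc)
  have L_mono: "L p \<le> L p'" if "p \<le> p'" for p p'
    using lift_Suc_mono_le[of L] L_less that by (metis less_imp_le)
  have total: "L N - L 0 \<le> q * m"
  proof -
    \<comment> \<open>The contribution of a task to the load in slot 0. Moving a task by whole days
      changes both quotients equally, so the sum over the cycle telescopes to \<open>b N\<close>,
      the number of days spanned.\<close>
    let ?h = "\<lambda>i. (0 - S i) div m - (0 - E i) div m"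
    have "?h (x p) = (0 - L p) div m - (0 - L (Suc p)) div m" for p
    proof -
      have "0 - S (x p) = (0 - L p) + b p * m" using b[of p] by simp
      moreover have "0 - E (x p) = (0 - L (Suc p)) + b p * m" using b[of p] L_Suc[of p] by simp
      ultimately show ?thesis using m by (simp only: div_mult_self1)
    qed
    then have "(\<Sum>p<N. ?h (x p)) = (\<Sum>p<N. (0 - L p) div m - (0 - L (Suc p)) div m)" by simp
    also have "\<dots> = (0 - L 0) div m - (0 - L N) div m" by (rule sum_lessThan_telescope')
    also have "0 - L 0 = (0 - L N) + b N * m" using b[of N] xN by (simp add: L_def)
    also have "\<dots> div m = b N + (0 - L N) div m" using m by (intro div_mult_self1) simp
    finally have "(\<Sum>p<N. ?h (x p)) = b N" by simp
    moreover have "(\<Sum>p<N. ?h (x p)) = sum ?h (x ` {0..<N})"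
      using inj by (simp add: sum.reindex lessThan_atLeast0)
    moreover have "\<dots> \<le> sum ?h T"
    proof (rule sum_mono2[OF fin])
      show "x ` {0..<N} \<subseteq> T" using xT by auto
      fix i assume "i \<in> T - x ` {0..<N}"
      then have "S i \<le> E i" using pos by force
      then show "0 \<le> ?h i" using zdiv_mono1[of "0 - E i" "0 - S i" m] m by simp
    qed
    ultimately have "b N \<le> q" using load[of 0] by simp
    then have "b N * m \<le> q * m" using m by simp
    moreover have "L N - L 0 = b N * m" using b[of N] xN by (simp add: L_def)
    ultimately show ?thesis by simp
  qed
  define a where "a i = b (inv_into {0..<N} x i)" for i
  have a: "a (x p) = b p" if "p < N" for p
    unfolding a_def using inv_into_f_f[OF inj] that by simp
  have block: "{S (x p) + a (x p) * m..<E (x p) + a (x p) * m} = {L p..<L (Suc p)}" if "p < N" for p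
    using a[OF that] b[of p] L_Suc[of p] by (simp add: add.commute)
  have uniq: "p \<le> p'" if "k \<in> {L p..<L (Suc p)}" "k \<in> {L p'..<L (Suc p')}" for k p p'
    using L_mono[of "Suc p'" p] that by (cases "p \<le> p'") auto
  show thesis
  proof (rule that)
    fix i j k c
    assume i: "i \<in> R" and j: "j \<in> R" and ki: "k \<in> {S i + a i * m..<E i + a i * m}"
      and kj: "k + c * (q * m) \<in> {S j + a j * m..<E j + a j * m}"
    obtain p p' where p: "p < N" "i = x p" and p': "p' < N" "j = x p'"
      using subsetD[OF R i] subsetD[OF R j] unfolding orb by auto
    have kp: "k \<in> {L p..<L (Suc p)}" using ki block[OF p(1)] p(2) by simp
    have kp': "k + c * (q * m) \<in> {L p'..<L (Suc p')}" using kj block[OF p'(1)] p'(2) by simp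
    \<comment> \<open>Both points lie in one window of length \<open>q * m\<close>, which leaves
      only \<open>c = 0\<close>.\<close>
    have r: "L 0 \<le> k" "k < L 0 + q * m"
      using kp L_mono[of 0 p] L_mono[of "Suc p" N] p(1) total by auto
    have r': "L 0 \<le> k + c * (q * m)" "k + c * (q * m) < L 0 + q * m"
      using kp' L_mono[of 0 p'] L_mono[of "Suc p'" N] p'(1) total by auto
    have qm: "q * m > 0" using r by linarith
    have "c * (q * m) < 1 * (q * m)" "(- 1) * (q * m) < c * (q * m)" using r r' by linarith+
    then have "c < 1" "- 1 < c" using qm by (metis mult_less_cancel_right_pos)+
    then have "c = 0" by linarith
    then show "i = j" using uniq[OF kp, of p'] uniq[of k p' p] kp kp' p p' by simp
  qed
qed

section \<open>Packing the tasks visited by one worker, in discrete time\<close>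

text \<open>
  Discrete version: time is split into unit slots, a day has \<open>m\<close> slots, and task \<open>i\<close> is active in
  slot \<open>k\<close> iff \<open>(k - S i) mod m < E i - S i\<close>, its current occurrence being number
  \<open>(k - S i) div m\<close>. Unit tasks \<open>Inr (k, c)\<close>, standing for idle workers, raise the load to \<open>q\<close> in
  every slot. In a slot where worker \<open>j\<close> has no task, one of these unit tasks is left for him, and the
  resulting itinerary of \<open>j\<close> shows that his tasks are connected to each other.
\<close>

lemma ex_packing_of_visited_tasks:
  fixes S E :: "'a \<Rightarrow> int" and g :: "'a \<Rightarrow> int \<Rightarrow> nat" and q :: nat
  assumes fin: "finite I" and m: "m > 0"
    and SE: "\<And>i. i \<in> I \<Longrightarrow> S i < E i" "\<And>i. i \<in> I \<Longrightarrow> E i \<le> S i + m"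
    and g: "\<And>i k. i \<in> I \<Longrightarrow> k \<ge> K \<Longrightarrow> (k - S i) mod m < E i - S i \<Longrightarrow>
      g i ((k - S i) div m) \<in> {1..q}"
    and feas: "\<And>i i' k. i \<in> I \<Longrightarrow> i' \<in> I \<Longrightarrow> k \<ge> K \<Longrightarrow> (k - S i) mod m < E i - S i \<Longrightarrow>
      (k - S i') mod m < E i' - S i' \<Longrightarrow> g i ((k - S i) div m) = g i' ((k - S i') div m) \<Longrightarrow> i = i'"
    and j: "j \<in> {1..q}"
    and visit: "\<And>i. i \<in> I \<Longrightarrow> \<exists>k\<ge>K. (k - S i) mod m < E i - S i \<and> g i ((k - S i) div m) = j"
  obtains a where "\<And>i i' k c. i \<in> I \<Longrightarrow> i' \<in> I \<Longrightarrow>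
      k \<in> {S i + a i * m..<E i + a i * m} \<Longrightarrow>
      k + c * (int q * m) \<in> {S i' + a i' * m..<E i' + a i' * m} \<Longrightarrow> i = i'"
proof (cases "I = {}")
  case True
  then show ?thesis using that by simp
next
  case False
  then obtain i0 where i0: "i0 \<in> I" by auto
  define act where "act i k \<longleftrightarrow> (k - S i) mod m < E i - S i" for i k
  define load where "load k = card {i \<in> I. act i k}" for k
  define W where "W k = {i \<in> I. act i k \<and> g i ((k - S i) div m) = j}" for k
  have inj: "inj_on (\<lambda>i. g i ((k - S i) div m)) {i \<in> I. act i k}" if "k \<ge> K" for k
    using feas that unfolding act_def by (auto intro!: inj_onI)
  have img: "(\<lambda>i. g i ((k - S i) div m)) ` {i \<in> I. act i k} \<subseteq> {1..q}" if "k \<ge> K" for k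
    using g that unfolding act_def by auto
  have load_le': "load k \<le> q" if "k \<ge> K" for k
    using card_inj_on_le[OF inj[OF that] img[OF that]] unfolding load_def by simp
  \<comment> \<open>With \<open>j\<close> idle, the active tasks go injectively to the other
    \<open>q - 1\<close> workers.\<close>
  have load_less: "load k < q" if "k \<ge> K" "W k = {}" for k
  proof -
    have "(\<lambda>i. g i ((k - S i) div m)) ` {i \<in> I. act i k} \<subseteq> {1..q} - {j}"
      using img[OF that(1)] that(2) unfolding W_def by auto
    from card_inj_on_le[OF inj[OF that(1)] this] show ?thesis
      using j unfolding load_def by (auto simp: card_Diff_singleton)
  qed
  have load_cong: "load k = load k'" if "k mod m = k' mod m" for k k'
  proof -
    have "(k - S i) mod m = (k' - S i) mod m" for i using that by (rule mod_diff_cong) simp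
    then show ?thesis unfolding load_def act_def by simp
  qed
  have load_le: "load k \<le> q" for k
  proof -
    \<comment> \<open>The hypotheses cover only slots from \<open>K\<close> on; by periodicity of
      the load, the bound is taken from a later day.\<close>
    obtain N where N: "K - k \<le> N" "0 \<le> N" by (metis abs_ge_self abs_ge_zero)
    let ?k = "k + N * m"
    have "N * 1 \<le> N * m" using m N by (intro mult_left_mono) auto
    then have "?k \<ge> K" using N by linarith
    then show ?thesis using load_le'[of ?k] load_cong[of k ?k] by simp
  qed
  define D where "D = (SIGMA k:{0..<m}. {..<q - load k})"
  define T where "T = I <+> D"
  define S' where "S' = case_sum S (fst :: int \<times> nat \<Rightarrow> int)"
  define E' where "E' = case_sum E (\<lambda>d :: int \<times> nat. fst d + 1)"
  have finD: "finite D" unfolding D_def by simp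
  have finT: "finite T" unfolding T_def using fin finD by simp
  have task_load: "(k - S i) div m - (k - E i) div m = (if act i k then 1 else 0)" if "i \<in> I" for i k
    using div_diff_eq_indicator[of "E i - S i" m "k - S i"] SE[OF that] unfolding act_def by simp
  have load_T: "(\<Sum>x\<in>T. (k - S' x) div m - (k - E' x) div m) = int q" for k
  proof -
    have "(\<Sum>x\<in>T. (k - S' x) div m - (k - E' x) div m)
       = (\<Sum>i\<in>I. (k - S i) div m - (k - E i) div m)
         + (\<Sum>d\<in>D. (k - fst d) div m - (k - (fst d + 1)) div m)"
      unfolding T_def using fin finD by (simp add: sum.Plus S'_def E'_def)
    also have "(\<Sum>i\<in>I. (k - S i) div m - (k - E i) div m) = int (load k)"
      using fin by (simp add: task_load sum.If_cases Int_def load_def)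
    also have "(\<Sum>d\<in>D. (k - fst d) div m - (k - (fst d + 1)) div m)
       = (\<Sum>d\<in>D. if fst d = k mod m then 1 else 0)"
    proof (rule sum.cong[OF refl])
      fix d assume "d \<in> D"
      then have d: "fst d mod m = fst d" unfolding D_def by auto
      have "(k - fst d) mod m < 1 \<longleftrightarrow> (k - fst d) mod m = 0"
        using pos_mod_sign[OF m, of "k - fst d"] by linarith
      also have "\<dots> \<longleftrightarrow> k mod m = fst d mod m"
        by (simp add: mod_eq_dvd_iff dvd_eq_mod_eq_0)
      also have "\<dots> \<longleftrightarrow> fst d = k mod m" unfolding d by (rule eq_commute)
      finally show "(k - fst d) div m - (k - (fst d + 1)) div m
          = (if fst d = k mod m then 1 else 0)"
        using div_diff_eq_indicator[of 1 m "k - fst d"] m by (simp add: algebra_simps)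
    qed
    also have "\<dots> = int (card {d \<in> D. fst d = k mod m})"
      using finD by (simp add: sum.If_cases Int_def)
    also have "{d \<in> D. fst d = k mod m} = {k mod m} \<times> {..<q - load (k mod m)}"
      unfolding D_def using m by auto
    also have "load (k mod m) = load k" by (rule load_cong) simp
    finally show ?thesis using load_le[of k] by simp
  qed
  \<comment> \<open>The itinerary of worker \<open>j\<close>. The filler numbered 0 belongs to
    \<open>T\<close> whenever \<open>j\<close> is idle, by \<open>load_less\<close>.\<close>
  define st where "st k = (if W k = {} then Inr (k mod m, 0 :: nat) else Inl (THE i. i \<in> W k))" for k
  have st_Inl: "st k = Inl i" if "k \<ge> K" "i \<in> W k" for k i
  proof -
    have "(THE i. i \<in> W k) = i"
      using that feas unfolding W_def act_def by (intro the_equality) auto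
    then show ?thesis unfolding st_def using that by auto
  qed
  have st_cases: "(\<exists>i. i \<in> W k \<and> st k = Inl i) \<or> (W k = {} \<and> st k = Inr (k mod m, 0))"
    if "k \<ge> K" for k
    by (metis st_Inl[OF that] st_def ex_in_conv)
  have st_T: "st k \<in> T" if "k \<ge> K" for k
  proof (cases "W k = {}")
    case True
    have "load (k mod m) = load k" by (rule load_cong) simp
    then have "(k mod m, 0) \<in> D" using load_less[OF that True] m unfolding D_def by simp
    then show ?thesis using True unfolding st_def T_def by auto
  next
    case False
    then show ?thesis using st_Inl[OF that] unfolding T_def W_def by force
  qed
  have st_ends: "E' (st k) mod m = (k + 1) mod m \<or> st (k + 1) = st k" if k: "k \<ge> K" for k
    using st_cases[OF k]
  proof (elim disjE exE conjE)
    assume "st k = Inr (k mod m, 0)"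
    then show ?thesis unfolding E'_def by (simp add: mod_add_left_eq)
  next
    fix i assume i: "i \<in> W k" and st: "st k = Inl i"
    have iI: "i \<in> I" and ik: "(k - S i) mod m < E i - S i" and gi: "g i ((k - S i) div m) = j"
      using i unfolding W_def act_def by auto
    define r where "r = (k - S i) mod m"
    have dec: "k - S i = m * ((k - S i) div m) + r" unfolding r_def by simp
    show ?thesis
    \<comment> \<open>Either \<open>k\<close> is the last slot of the occurrence, or slot
      \<open>k + 1\<close> belongs to the same occurrence and hence to the same worker.\<close>
    proof (cases "r + 1 = E i - S i")
      case True
      then have "k + 1 = E i + m * ((k - S i) div m)" using dec by linarith
      then have "(k + 1) mod m = E i mod m" by (metis mod_mult_self2)
      then show ?thesis using st unfolding E'_def by simp
    next
      case False
      have eq: "k + 1 - S i = m * ((k - S i) div m) + (r + 1)" using dec by linarith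
      have "0 \<le> r + 1" "r + 1 < m"
        using pos_mod_sign[OF m, of "k - S i"] False SE[OF iI] ik unfolding r_def by linarith+
      then have "(k + 1 - S i) div m = (k - S i) div m" "(k + 1 - S i) mod m = r + 1"
        using int_div_pos_eq[OF eq] int_mod_pos_eq[OF eq] by simp_all
      then have "i \<in> W (k + 1)"
        using iI gi ik False unfolding W_def act_def r_def by auto
      then show ?thesis using st_Inl[of "k + 1" i] k st by simp
    qed
  qed
  have st_starts: "S' (st (k + 1)) mod m = (k + 1) mod m \<or> st (k + 1) = st k" if k: "k \<ge> K" for k
  proof -
    have k1: "k + 1 \<ge> K" using k by simp
    show ?thesis using st_cases[OF k1]
    proof (elim disjE exE conjE)
      assume "st (k + 1) = Inr ((k + 1) mod m, 0)"
      then show ?thesis unfolding S'_def by simp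
    next
      fix i assume i: "i \<in> W (k + 1)" and st: "st (k + 1) = Inl i"
      have iI: "i \<in> I" and ik: "(k + 1 - S i) mod m < E i - S i"
        and gi: "g i ((k + 1 - S i) div m) = j"
        using i unfolding W_def act_def by auto
      define r where "r = (k + 1 - S i) mod m"
      have dec: "k + 1 - S i = m * ((k + 1 - S i) div m) + r" unfolding r_def by simp
      show ?thesis
      proof (cases "r = 0")
        case True
        then have "k + 1 = S i + m * ((k + 1 - S i) div m)" using dec by linarith
        then have "(k + 1) mod m = S i mod m" by (metis mod_mult_self2)
        then show ?thesis using st unfolding S'_def by simp
      next
        case False
        have eq: "k - S i = m * ((k + 1 - S i) div m) + (r - 1)" using dec by linarith
        have "0 \<le> r - 1" "r - 1 < m"
          using pos_mod_sign[OF m, of "k + 1 - S i"] pos_mod_bound[OF m, of "k + 1 - S i"] False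
          unfolding r_def by linarith+
        then have "(k - S i) div m = (k + 1 - S i) div m" "(k - S i) mod m = r - 1"
          using int_div_pos_eq[OF eq] int_mod_pos_eq[OF eq] by simp_all
        then have "i \<in> W k"
          using iI gi ik False unfolding W_def act_def r_def by auto
        then show ?thesis using st_Inl[of k i] k st by simp
      qed
    qed
  qed
  have connected: "\<forall>U\<subseteq>T. Inl i0 \<in> U \<longrightarrow>
      (\<forall>x\<in>T. \<forall>y\<in>T. E' x mod m = S' y mod m \<longrightarrow> (x \<in> U \<longleftrightarrow> y \<in> U)) \<longrightarrow> Inl ` I \<subseteq> U"
  proof (intro allI impI)
    fix U
    assume U0: "Inl i0 \<in> U"
      and U: "\<forall>x\<in>T. \<forall>y\<in>T. E' x mod m = S' y mod m \<longrightarrow> (x \<in> U \<longleftrightarrow> y \<in> U)"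
    \<comment> \<open>If the item changes, the old one ends and the new one starts at
      \<open>k + 1\<close> modulo \<open>m\<close>, so they are linked.\<close>
    have step: "st (k + 1) \<in> U \<longleftrightarrow> st k \<in> U" if k: "k \<ge> K" for k
      using st_ends[OF k] st_starts[OF k] U st_T[OF k] st_T[of "k + 1"] k by auto
    have all: "st k \<in> U \<longleftrightarrow> st K \<in> U" if "k \<ge> K" for k
      using that by (induction k rule: int_ge_induct) (simp_all add: step)
    have visited: "\<exists>k\<ge>K. st k = Inl i" if i: "i \<in> I" for i
    proof -
      obtain k where "k \<ge> K" "i \<in> W k" using visit[OF i] i unfolding W_def act_def by blast
      then show ?thesis using st_Inl by blast
    qed
    have "st K \<in> U" using visited[OF i0] all U0 by metis
    then show "Inl ` I \<subseteq> U" using visited all by (metis image_subsetI)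
  qed
  have i0T: "Inl i0 \<in> T" using i0 unfolding T_def by (rule InlI)
  have pos: "S' x < E' x" if "x \<in> T" for x
    using that SE unfolding T_def S'_def E'_def by auto
  obtain a where a: "\<And>x y k c. x \<in> Inl ` I \<Longrightarrow> y \<in> Inl ` I \<Longrightarrow>
      k \<in> {S' x + a x * m..<E' x + a x * m} \<Longrightarrow>
      k + c * (int q * m) \<in> {S' y + a y * m..<E' y + a y * m} \<Longrightarrow> x = y"
    using ex_circular_packing[OF finT m i0T pos load_T connected] by blast
  show ?thesis
  proof (rule that[of "a \<circ> Inl"])
    fix i i' k c
    assume "i \<in> I" "i' \<in> I" "k \<in> {S i + (a \<circ> Inl) i * m..<E i + (a \<circ> Inl) i * m}"
      "k + c * (int q * m) \<in> {S i' + (a \<circ> Inl) i' * m..<E i' + (a \<circ> Inl) i' * m}"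
    then show "i = i'" using a[of "Inl i" "Inl i'" k c] by (simp add: S'_def E'_def)
  qed
qed

section \<open>Reduction from real time to slots\<close>

text \<open>
  \<open>slot B\<close> relabels time so that the breakpoints \<open>B\<close> and their integer translates become consecutive
  integers; a day has \<open>card B\<close> slots.
\<close>

definition slot :: "real set \<Rightarrow> real \<Rightarrow> int" where
  "slot B x = int (card B) * \<lfloor>x\<rfloor> + int (card {b \<in> B. b \<le> frac x})"

lemma slot_add_of_int: "slot B (x + of_int r) = slot B x + r * int (card B)"
  by (simp add: slot_def frac_def algebra_simps)

lemma slot_mono:
  assumes fin: "finite B" and xy: "x \<le> y"
  shows "slot B x \<le> slot B y"
proof (cases "\<lfloor>x\<rfloor> = \<lfloor>y\<rfloor>")
  case True
  then have "{b \<in> B. b \<le> frac x} \<subseteq> {b \<in> B. b \<le> frac y}" using xy by (auto simp: frac_def)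
  then show ?thesis using True fin by (simp add: slot_def card_mono)
next
  case False
  then have "\<lfloor>x\<rfloor> + 1 \<le> \<lfloor>y\<rfloor>" using floor_mono[OF xy] by simp
  then have "int (card B) * (\<lfloor>x\<rfloor> + 1) \<le> int (card B) * \<lfloor>y\<rfloor>" by (intro mult_left_mono) auto
  moreover have "card {b \<in> B. b \<le> frac x} \<le> card B" using fin by (simp add: card_mono)
  ultimately show ?thesis by (simp add: slot_def distrib_left)
qed

text \<open>The breakpoint \<open>frac y\<close> is counted at \<open>y\<close> but not yet at
  \<open>x\<close>. With right endpoints as \<open>y\<close>, half-open intervals go into half-open
  blocks of slots.\<close>

lemma slot_strict_mono:
  assumes fin: "finite B" and xy: "x < y" and y: "frac y \<in> B"
  shows "slot B x < slot B y"
proof (cases "\<lfloor>x\<rfloor> = \<lfloor>y\<rfloor>")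
  case True
  then have "frac x < frac y" using xy by (auto simp: frac_def)
  then have "{b \<in> B. b \<le> frac x} \<subset> {b \<in> B. b \<le> frac y}" using y by force
  then show ?thesis using True fin by (simp add: slot_def psubset_card_mono)
next
  case False
  then have "\<lfloor>x\<rfloor> + 1 \<le> \<lfloor>y\<rfloor>" using floor_mono[of x y] xy by simp
  then have "int (card B) * (\<lfloor>x\<rfloor> + 1) \<le> int (card B) * \<lfloor>y\<rfloor>" by (intro mult_left_mono) auto
  moreover have "card {b \<in> B. b \<le> frac x} \<le> card B" using fin by (simp add: card_mono)
  moreover have "card {b \<in> B. b \<le> frac y} > 0" using fin y by (auto simp: card_gt_0_iff)
  ultimately show ?thesis by (simp add: slot_def distrib_left)
qed

text \<open>Cutting time at all endpoints makes nonempty intervals overlap exactly when their blocks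
  of slots do, so feasibility passes to slots and the packing passes back.\<close>

lemma ex_real_packing:
  assumes inst: "is_instance n s e q" and f: "f \<in> assignments n q" and feas: "feasible n s e f"
    and j: "j \<in> {1..q}" and visit: "\<forall>i\<in>{1..n}. \<exists>r\<ge>1. f (i, r) = j"
  obtains a :: "nat \<Rightarrow> int" where "\<And>i i' t c. i \<in> {1..n} \<Longrightarrow> i' \<in> {1..n} \<Longrightarrow>
      t \<in> {s i + of_int (a i)..<e i + of_int (a i)} \<Longrightarrow>
      t + of_int (c * int q) \<in> {s i' + of_int (a i')..<e i' + of_int (a i')} \<Longrightarrow> i = i'"
proof -
  \<comment> \<open>Empty intervals would violate \<open>S i < E i\<close>; they contain no point,
    so any shift suits them.\<close>
  define I where "I = {i \<in> {1..n}. s i < e i}"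
  \<comment> \<open>The element \<open>0\<close> keeps \<open>m\<close> positive even when
    \<open>I\<close> is empty.\<close>
  define B where "B = insert 0 ((\<lambda>i. frac (s i)) ` I \<union> (\<lambda>i. frac (e i)) ` I)"
  define m where "m = int (card B)"
  define S where "S i = slot B (s i)" for i
  define E where "E i = slot B (e i)" for i
  have finI: "finite I" unfolding I_def by simp
  have finB: "finite B" unfolding B_def using finI by simp
  have m: "m > 0" unfolding m_def using finB by (auto simp: B_def card_gt_0_iff)
  have shift: "slot B (x + of_int r) = slot B x + r * m" for x r
    unfolding m_def by (rule slot_add_of_int)
  note mono = slot_mono[OF finB] and strict = slot_strict_mono[OF finB]
  have e: "0 < e i" "e i \<le> 1" "e i \<le> s i + 1" "s i < e i" "frac (e i) \<in> B" if "i \<in> I" for i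
    using inst that unfolding is_instance_def I_def B_def by (force simp: algebra_simps)+
  have SE: "S i < E i" if "i \<in> I" for i
    unfolding S_def E_def using e[OF that] by (intro strict)
  have ES: "E i \<le> S i + m" if "i \<in> I" for i
    using mono[OF e(3)[OF that]] shift[of "s i" 1] unfolding S_def E_def by simp
  have in_block: "slot B t \<in> {S i + r * m..<E i + r * m}"
    if "i \<in> I" "t \<in> {s i + of_int r..<e i + of_int r}" for i r t
  proof -
    have "frac (e i + of_int r) \<in> B" using e(5)[OF that(1)] by (simp add: frac_def)
    then show ?thesis
      using that(2) mono[of "s i + of_int r" t] strict[of t "e i + of_int r"]
      by (simp add: S_def E_def shift)
  qed
  have block_less: "s i + of_int r < e i' + of_int r'"
    if "S i + r * m \<le> k" "k < E i' + r' * m" for i i' r r' k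
    using mono[of "e i' + of_int r'" "s i + of_int r"] that by (force simp: S_def E_def shift)
  have active: "S i + (k - S i) div m * m \<le> k" "k < E i + (k - S i) div m * m"
    if "(k - S i) mod m < E i - S i" for i k
    using div_mult_mod_eq[of "k - S i" m] pos_mod_sign[OF m, of "k - S i"] that by linarith+
  \<comment> \<open>Occurrence 0 of each task is over by time 1. From \<open>slot B 1\<close> on,
    only occurrences numbered from 1 are met, where \<open>f\<close> is constrained and
    \<open>nat\<close> loses nothing.\<close>
  have late: "(k - S i) div m \<ge> 1"
    if "i \<in> I" "k \<ge> slot B 1" "(k - S i) mod m < E i - S i" for i k
  proof -
    have "E i \<le> slot B 1" unfolding E_def using e(2)[OF that(1)] by (rule mono)
    then have "0 * m < (k - S i) div m * m" using active[OF that(3)] that(2) by linarith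
    then show ?thesis using m by (simp add: zero_less_mult_iff)
  qed
  obtain a where a: "\<And>i i' k c. i \<in> I \<Longrightarrow> i' \<in> I \<Longrightarrow>
      k \<in> {S i + a i * m..<E i + a i * m} \<Longrightarrow>
      k + c * (int q * m) \<in> {S i' + a i' * m..<E i' + a i' * m} \<Longrightarrow> i = i'"
  proof (rule ex_packing_of_visited_tasks
        [where K = "slot B 1" and g = "\<lambda>i r. f (i, nat r)" and q = q and j = j, OF finI m SE ES])
    fix i k assume i: "i \<in> I" and k: "slot B 1 \<le> k" "(k - S i) mod m < E i - S i"
    have "nat ((k - S i) div m) \<ge> 1" using late[OF i k] by simp
    then show "f (i, nat ((k - S i) div m)) \<in> {1..q}"
      using f i unfolding assignments_def I_def by (auto simp: Pi_iff)
  next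
    fix i i' k
    assume i: "i \<in> I" "i' \<in> I" and k: "slot B 1 \<le> k"
      and act: "(k - S i) mod m < E i - S i" "(k - S i') mod m < E i' - S i'"
      and eq: "f (i, nat ((k - S i) div m)) = f (i', nat ((k - S i') div m))"
    let ?r = "(k - S i) div m" and ?r' = "(k - S i') div m"
    have r: "?r \<ge> 1" "?r' \<ge> 1" using late i k act by auto
    \<comment> \<open>Sharing slot \<open>k\<close>, each occurrence starts before the other ends,
      so the later start is a common point.\<close>
    have "max (s i + of_int ?r) (s i' + of_int ?r')
        \<in> occurrence s e i (nat ?r) \<inter> occurrence s e i' (nat ?r')"
      using block_less[OF active(1)[OF act(1)] active(2)[OF act(2)]]
        block_less[OF active(1)[OF act(2)] active(2)[OF act(1)]] e(4)[OF i(1)] e(4)[OF i(2)] r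
      unfolding occurrence_def by (auto simp: of_nat_nat)
    then have "occurrence s e i (nat ?r) \<inter> occurrence s e i' (nat ?r') \<noteq> {}" by blast
    moreover have "nat ?r \<ge> 1" "nat ?r' \<ge> 1" using r by simp_all
    moreover have "i \<in> {1..n}" "i' \<in> {1..n}" using i unfolding I_def by simp_all
    ultimately show "i = i'" using feas eq unfolding feasible_def by blast
  next
    fix i assume i: "i \<in> I"
    then obtain r where r: "r \<ge> 1" "f (i, r) = j" using visit unfolding I_def by blast
    \<comment> \<open>The last slot of occurrence \<open>r\<close>. Even for \<open>r = 1\<close> it
      is not before \<open>slot B 1\<close>, because \<open>e i > 0\<close>; the first slot might
      be.\<close>
    let ?k = "E i + int r * m - 1"
    have "slot B 1 = slot B 0 + m" using shift[of 0 1] by simp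
    moreover have "slot B 0 < E i" unfolding E_def using e[OF i] by (intro strict)
    moreover have "1 * m \<le> int r * m" using r m by (intro mult_right_mono) auto
    ultimately have K: "?k \<ge> slot B 1" by linarith
    have eq: "?k - S i = m * int r + (E i - S i - 1)" by (simp add: mult.commute)
    have "0 \<le> E i - S i - 1" "E i - S i - 1 < m" using SE[OF i] ES[OF i] by linarith+
    then have "(?k - S i) div m = int r" "(?k - S i) mod m = E i - S i - 1"
      using int_div_pos_eq[OF eq] int_mod_pos_eq[OF eq] by blast+
    then show "\<exists>k\<ge>slot B 1. (k - S i) mod m < E i - S i \<and> f (i, nat ((k - S i) div m)) = j"
      using K r by (intro exI[of _ ?k]) simp
  qed (use j in auto)
  show thesis
  proof (rule that)
    fix i i' t c
    assume i: "i \<in> {1..n}" "i' \<in> {1..n}" and t: "t \<in> {s i + of_int (a i)..<e i + of_int (a i)}"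
      and t': "t + of_int (c * int q) \<in> {s i' + of_int (a i')..<e i' + of_int (a i')}"
    have I: "i \<in> I" "i' \<in> I" using i t t' unfolding I_def by auto
    have "slot B t \<in> {S i + a i * m..<E i + a i * m}" by (rule in_block[OF I(1) t])
    moreover have "slot B t + c * (int q * m) \<in> {S i' + a i' * m..<E i' + a i' * m}"
      using in_block[OF I(2) t'] unfolding shift by (simp only: mult.assoc)
    ultimately show "i = i'" by (rule a[OF I])
  qed
qed

section \<open>From a packing to a balanced periodic assignment\<close>

text \<open>Worker \<open>j\<close> runs round the packed circle with delay \<open>j - 1\<close>,
  and so performs the occurrences \<open>r\<close> of task \<open>i\<close> congruent to
  \<open>a i + j - 1\<close> modulo \<open>q\<close>, a class of density
  \<open>1 / q\<close>.\<close>

lemma ex_periodic_assignment: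
  assumes inst: "is_instance n s e q"
    and packing: "\<And>i i' t c. i \<in> {1..n} \<Longrightarrow> i' \<in> {1..n} \<Longrightarrow>
      t \<in> {s i + of_int (a i)..<e i + of_int (a i)} \<Longrightarrow>
      t + of_int (c * int q) \<in> {s i' + of_int (a i')..<e i' + of_int (a i')} \<Longrightarrow> i = i'"
  shows "\<exists>f\<in>assignments n q. feasible n s e f \<and> balanced n q f \<and> periodic n q f"
proof
  define f where "f = (\<lambda>(i, r). nat ((int r - a i) mod int q) + 1)"
  have q: "q > 0" using inst unfolding is_instance_def by simp
  have mod_bounds: "0 \<le> x mod int q" "x mod int q < int q" for x using q by simp_all
  show "f \<in> assignments n q"
    using mod_bounds unfolding assignments_def f_def by (auto simp: Suc_le_eq nat_less_iff)
  have "feasible n s e f" unfolding feasible_def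
  proof (intro ballI allI impI)
    fix i i' r r'
    assume i: "i \<in> {1..n}" "i' \<in> {1..n}" and ne: "i \<noteq> i'"
      and "occurrence s e i r \<inter> occurrence s e i' r' \<noteq> {}"
    then obtain t where t: "t \<in> {s i + real r..<e i + real r}" "t \<in> {s i' + real r'..<e i' + real r'}"
      unfolding occurrence_def by blast
    show "f (i, r) \<noteq> f (i', r')"
    proof
      assume "f (i, r) = f (i', r')"
      then have "(int r - a i) mod int q = (int r' - a i') mod int q"
        using mod_bounds(1) by (simp add: f_def eq_nat_nat_iff)
      then have "int q dvd (int r - a i) - (int r' - a i')" by (simp add: mod_eq_dvd_iff)
      then obtain c where c: "(int r - a i) - (int r' - a i') = c * int q"
        by (metis dvd_def mult.commute)
      \<comment> \<open>Undoing the delay \<open>r - a i\<close> moves \<open>t\<close> into the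
        packed interval of \<open>i\<close>, and undoing \<open>r' - a i'\<close> into that of
        \<open>i'\<close>; the two images differ by \<open>c * q\<close>.\<close>
      let ?t = "t + of_int (a i - int r)"
      have "?t + of_int (c * int q) = t + of_int (a i' - int r')"
        unfolding c[symmetric] by simp
      then have "i = i'" using t by (intro packing[OF i, of ?t c]) auto
      then show False using ne by simp
    qed
  qed
  moreover have "balanced n q f" unfolding balanced_def
  proof (intro ballI)
    fix i j assume j: "j \<in> {1..q}"
    have "f (i, r) = j \<longleftrightarrow> (int r - (a i + int j - 1)) mod int q = 0" for r
    proof -
      have "f (i, r) = j \<longleftrightarrow> (int r - a i) mod int q = int j - 1"
        using mod_bounds[of "int r - a i"] j unfolding f_def by auto
      also have "\<dots> \<longleftrightarrow> (int r - a i) mod int q = (int j - 1) mod int q" using j by simp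
      also have "\<dots> \<longleftrightarrow> int q dvd int r - a i - (int j - 1)" by (simp add: mod_eq_dvd_iff)
      also have "int r - a i - (int j - 1) = int r - (a i + int j - 1)" by simp
      finally show ?thesis by (simp add: dvd_eq_mod_eq_0)
    qed
    then show "(\<lambda>t. 1 / real t * real (card {r \<in> {1..t}. f (i, r) = j})) \<longlonglongrightarrow> 1 / real q"
      using residue_class_density[OF q, of "a i + int j - 1"] by simp
  qed
  moreover have "periodic n q f"
  proof -
    have "(int (r + q) - a i) mod int q = (int r - a i) mod int q" for i r
      using mod_add_self2[of "int r - a i" "int q"] by (simp add: algebra_simps)
    then show ?thesis using q unfolding periodic_def f_def by simp
  qed
  ultimately show "feasible n s e f \<and> balanced n q f \<and> periodic n q f" by blast
qed

text \<open>Otherwise all frequencies vanish and cannot tend to the positive number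
  \<open>1 / q\<close>.\<close>

lemma balanced_imp_performed:
  assumes bal: "balanced n q f" and i: "i \<in> {1..n}" and j: "j \<in> {1..q}"
  shows "\<exists>r\<ge>1. f (i, r) = j"
proof (rule ccontr)
  assume "\<not> ?thesis"
  then have "{r \<in> {1..t}. f (i, r) = j} = {}" for t by auto
  moreover have "(\<lambda>t. 1 / real t * real (card {r \<in> {1..t}. f (i, r) = j})) \<longlonglongrightarrow> 1 / real q"
    using bal i j unfolding balanced_def by blast
  ultimately have "(\<lambda>t::nat. 0) \<longlonglongrightarrow> 1 / real q" by (simp only: card.empty) simp
  then have "1 / real q = 0" using LIMSEQ_unique tendsto_const by blast
  then show False using j by simp
qed

theorem theorem1p1:
  fixes n q :: nat and s e :: "nat \<Rightarrow> real"
  assumes "is_instance n s e q"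
  shows
    "((\<exists>f \<in> assignments n q. feasible n s e f \<and>
          (\<exists>j\<in>{1..q}. \<forall>i\<in>{1..n}. \<exists>r\<ge>1. f (i, r) = j))
       \<longleftrightarrow> (\<exists>f \<in> assignments n q. feasible n s e f \<and> balanced n q f))
     \<and> ((\<exists>f \<in> assignments n q. feasible n s e f \<and> balanced n q f)
       \<longleftrightarrow> (\<exists>f \<in> assignments n q. feasible n s e f \<and> balanced n q f \<and> periodic n q f))"
    (is "(?a \<longleftrightarrow> ?b) \<and> (?b \<longleftrightarrow> ?c)")
proof -
  have "?c" if "?a"
  proof -
    obtain f j where fj: "f \<in> assignments n q" "feasible n s e f" "j \<in> {1..q}"
      "\<forall>i\<in>{1..n}. \<exists>r\<ge>1. f (i, r) = j" using \<open>?a\<close> by blast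
    obtain a where a: "\<And>i i' t c. i \<in> {1..n} \<Longrightarrow> i' \<in> {1..n} \<Longrightarrow>
      t \<in> {s i + of_int (a i)..<e i + of_int (a i)} \<Longrightarrow>
      t + of_int (c * int q) \<in> {s i' + of_int (a i')..<e i' + of_int (a i')} \<Longrightarrow> i = i'"
      using ex_real_packing[OF assms fj] by blast
    show ?thesis by (rule ex_periodic_assignment[OF assms a])
  qed
  moreover have "?a" if "?b"
  proof -
    have "1 \<in> {1..q}" using assms unfolding is_instance_def by simp
    then show ?thesis using \<open>?b\<close> balanced_imp_performed by blast
  qed
  ultimately show ?thesis by blast
qed

end
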